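(* Let $I=[a,b)$ be a bounded nonempty real interval and let $r>0$. Then $$\sup_{\alpha\in\mathfrak{S}_2(I)}\|\mathcal{A}_{\alpha,r}\|_{(1,1)}=\left(\frac{2^{r+1}-1}{2^r-1}\right)^{1/r}.$$
   Context: Dyadic lattice: for $J=[c,d)$ let $J_-$ and $J_+$ be its left and right halves (half-open). Define $\mathcal{D}_0(I)=\{I\}$, $\mathcal{D}_{k+1}(I)=\{J_-,J_+: J\in\mathcal{D}_k(I)\}$ and $\mathcal{D}(I)=\bigcup_{k\ge 0}\mathcal{D}_k(I)$. Write $|E|$ for Lebesgue measure and $\langle f\rangle_J=\frac1{|J|}\int_J f(t)\,dt$. A binary sequence adapted to $I$ is a family $\alpha=\{\alpha_J\}_{J\in\mathcal{D}(I)}$ with $\alpha_J\in\{0,1\}$. For $J\in\mathcal{D}(I)$ put $A(\alpha;J)=\frac1{|J|}\sum_{K\in\mathcal{D}(J)}\alpha_K|K|$. The set $\mathfrak{S}_2(I)$ consists of all binary sequences adapted to $I$ that are $2$-Carleson, i.e. $\sup_{J\in\mathcal{D}(I)}A(\alpha;J)\le 2$. For $r>0$ and $\alpha\in\mathfrak{S}_2(I)$ the (localized) sparse operator is $$\mathcal{A}_{\alpha,r}f(t)=\Big(\sum_{J\in\mathcal{D}(I)}\alpha_J\,\langle|f|\rangle_J^r\,\mathbf{1}_J(t)\Big)^{1/r},\qquad t\in I.$$ $\|\mathcal{A}_{\alpha,r}\|_{(1,1)}$ denotes the operator norm $\|\mathcal{A}_{\alpha,r}:L^1(I)\to L^{1,\infty}(I)\|$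 with respect to Lebesgue measure, i.e. the smallest constant $C\ge0$ such that $|\{t\in I:\mathcal{A}_{\alpha,r}f(t)\ge\lambda\}|\le\frac{C}{\lambda}\int_I|f(t)|\,dt$ for all $f\in L^1(I)$ and all $\lambda>0$. *)

theory Defs
  imports "HOL-Analysis.Analysis"
begin

text \<open>Intervals are sets of reals; \<open>left_half\<close> and \<open>right_half\<close> recover the endpoints of a
  half-open interval as its infimum and supremum (see the two lemmas below).\<close>

definition left_half :: "real set \<Rightarrow> real set" where
  "left_half J = {Inf J ..< (Inf J + Sup J) / 2}"

definition right_half :: "real set \<Rightarrow> real set" where
  "right_half J = {(Inf J + Sup J) / 2 ..< Sup J}"

lemma left_half_ivl: "c < d \<Longrightarrow> left_half {c..<d} = {c..<(c + d) / 2}"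
  by (simp add: left_half_def)

lemma right_half_ivl: "c < d \<Longrightarrow> right_half {c..<d} = {(c + d) / 2..<d}"
  by (simp add: right_half_def)

primrec dyadic_gen :: "nat \<Rightarrow> real set \<Rightarrow> real set set" where
  "dyadic_gen 0 I = {I}"
| "dyadic_gen (Suc k) I = (\<Union>J\<in>dyadic_gen k I. {left_half J, right_half J})"

definition dyadic :: "real set \<Rightarrow> real set set" where
  "dyadic I = (\<Union>k. dyadic_gen k I)"

text \<open>A family indexed by \<open>dyadic I\<close> is a total function on sets of reals; its values outside
  \<open>dyadic I\<close> are never used.\<close>

definition binary_seq :: "real set \<Rightarrow> (real set \<Rightarrow> real) \<Rightarrow> bool" where
  "binary_seq I \<alpha> \<longleftrightarrow> (\<forall>J\<in>dyadic I. \<alpha> J \<in> {0, 1})"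

text \<open>The Carleson averages are infinite sums of nonnegative terms and may diverge, so they are
  taken in \<^typ>\<open>ennreal\<close>, where every such sum exists.\<close>

definition carleson_avg :: "(real set \<Rightarrow> real) \<Rightarrow> real set \<Rightarrow> ennreal" where
  "carleson_avg \<alpha> J =
     (\<Sum>\<^sub>\<infinity>K\<in>dyadic J. ennreal (\<alpha> K) * emeasure lebesgue K) / emeasure lebesgue J"

definition two_carleson_seqs :: "real set \<Rightarrow> (real set \<Rightarrow> real) set" where
  "two_carleson_seqs I = {\<alpha>. binary_seq I \<alpha> \<and> (SUP J\<in>dyadic I. carleson_avg \<alpha> J) \<le> 2}"

definition average :: "(real \<Rightarrow> real) \<Rightarrow> real set \<Rightarrow> real" where
  "average f J = (1 / measure lebesgue J) * (LINT t:J|lebesgue. f t)"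

text \<open>Real powers of extended nonnegative reals, meant for exponents \<open>p > 0\<close>.\<close>

definition ennreal_powr :: "ennreal \<Rightarrow> real \<Rightarrow> ennreal" where
  "ennreal_powr x p = (if x = top then top else ennreal (enn2real x powr p))"

text \<open>The sum defining the operator can be infinite at some points, hence the value type.\<close>

definition sparse_op ::
  "real set \<Rightarrow> (real set \<Rightarrow> real) \<Rightarrow> real \<Rightarrow> (real \<Rightarrow> real) \<Rightarrow> real \<Rightarrow> ennreal" where
  "sparse_op I \<alpha> r f t =
     ennreal_powr
       (\<Sum>\<^sub>\<infinity>J\<in>dyadic I. ennreal (\<alpha> J * average (\<lambda>x. \<bar>f x\<bar>) J powr r * indicator J t)) (1 / r)"

text \<open>The least admissible constant, with value \<open>top\<close> (the infimum of the empty set) if no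
  finite constant is admissible.\<close>

definition weak_type_norm ::
  "real set \<Rightarrow> ((real \<Rightarrow> real) \<Rightarrow> real \<Rightarrow> ennreal) \<Rightarrow> ennreal" where
  "weak_type_norm I T =
     Inf {ennreal C | C. 0 \<le> C \<and>
       (\<forall>f l. set_integrable lebesgue I f \<longrightarrow> 0 < l \<longrightarrow>
          emeasure lebesgue {t \<in> I. ennreal l \<le> T f t}
            \<le> ennreal (C / l * (LINT t:I|lebesgue. \<bar>f t\<bar>)))}"

end

theory Submission
  imports Defs
begin

text \<open>Write \<open>d = 2 powr r / (2 powr r - 1)\<close>; the constant on the right is then
  \<open>(1 + d) powr (1 / r)\<close>.

  The upper bound is a Bellman function argument. Give each dyadic interval the data \<open>x\<close> (the average
  of \<open>\<bar>f\<bar>\<close>), \<open>A\<close> (the Carleson average) and \<open>w\<close> (the \<open>r\<close>-th power of the level, minus what the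
  selected ancestors have contributed). The proportion of the interval on which the level is reached
  is at most \<open>(1 + d) powr (1 / r)\<close> times
  \<open>bellman r w x A = (w * x powr - r + d * A powr - r) powr (- 1 / r)\<close>.
  Three properties make this function a majorant: it is concave in \<open>(x, A)\<close>
  (\<open>bellman_midpoint\<close>), so it survives the passage from halves to parent; it dominates its value
  after a selection (\<open>bellman_select\<close>), with equality at \<open>A = 2\<close>; and it is at least
  \<open>(1 + d) powr (- 1 / r)\<close> when a selection reaches the level (\<open>bellman_terminal\<close>). Induction on
  the number of generations (\<open>measure_partial_sparse_level_le\<close>) and a monotone limit
  (\<open>sparse_op_weak_type\<close>) give the weak-type inequality, since
  \<open>bellman r w x A \<le> x * w powr (- 1 / r)\<close>.

  For the lower bound, equality in these steps dictates the sequence: keep the Carleson average at 2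
  by descending to the left half at each step, with averages doubling, and at the end spend the
  remaining Carleson mass 1 on both halves at once. With \<open>f\<close> the indicator of the parent of
  these two halves, in generation \<open>n\<close>, the sum of \<open>r\<close>-th powers on that parent is
  \<open>(\<Sum>j\<le>n. 2 powr (- r * j)) + 1\<close>, which tends to \<open>d + 1\<close>
  (\<open>extremal_value_le_weak_type_norm\<close>, \<open>extremal_value_tendsto\<close>).\<close>

section \<open>The Bellman function\<close>

lemma convex_on_powr_neg:
  fixes p :: real
  assumes "p \<le> 0"
  shows "convex_on {0<..} (\<lambda>x. x powr p)"
proof (rule f''_ge0_imp_convex)
  fix x :: real assume "x \<in> {0<..}"
  then have x: "x > 0" by simp
  show "DERIV (\<lambda>x. x powr p) x :> p * x powr (p - 1)"
    using x by (rule has_real_derivative_powr)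
  show "DERIV (\<lambda>x. p * x powr (p - 1)) x :> p * ((p - 1) * x powr (p - 1 - 1))"
    using x by (intro DERIV_cmult has_real_derivative_powr)
  show "0 \<le> p * ((p - 1) * x powr (p - 1 - 1))"
    using assms by (simp add: mult_nonpos_nonpos mult_nonpos_nonneg)
qed simp

text \<open>For \<open>d = carleson_weight r\<close> the identity \<open>d * (1 - 2 powr - r) = 1\<close> says that passing
  from Carleson average 2 to 1 raises \<open>d * A powr - r\<close> by exactly 1; this is the balance that
  makes \<open>bellman_select\<close> sharp. The constant of the theorem is \<open>(1 + d) powr (1 / r)\<close>.\<close>
definition carleson_weight :: "real \<Rightarrow> real" where
  "carleson_weight r = 2 powr r / (2 powr r - 1)"

text \<open>Here \<open>x\<close> stands for the average of \<open>\<bar>f\<bar>\<close> over an interval, \<open>A\<close> for its Carleson average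
  and \<open>w\<close> for what is still missing from the \<open>r\<close>-th power of the level. As a function of
  \<open>(x, A)\<close> it is a weighted power mean of order \<open>- r\<close>, up to normalization; the value at
  \<open>x = 0\<close> or \<open>A = 0\<close> is its continuous extension and has to be given separately, because
  \<open>0 powr - r = 0\<close>.\<close>
definition bellman :: "real \<Rightarrow> real \<Rightarrow> real \<Rightarrow> real \<Rightarrow> real" where
  "bellman r w x A =
     (if x > 0 \<and> A > 0
      then (w * x powr - r + carleson_weight r * A powr - r) powr (- 1 / r) else 0)"

lemma carleson_weight_pos: "r > 0 \<Longrightarrow> carleson_weight r > 0"
  by (simp add: carleson_weight_def)

lemma bellman_nonneg: "0 \<le> bellman r w x A"
  by (simp add: bellman_def)

lemma bellman_pos:
  assumes "r > 0" "w > 0" "x > 0" "A > 0"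
  shows "0 < bellman r w x A"
proof -
  have "0 < w * x powr - r + carleson_weight r * A powr - r"
    using assms carleson_weight_pos[of r] by (intro add_pos_pos mult_pos_pos) auto
  then show ?thesis using assms by (simp add: bellman_def)
qed

text \<open>By homogeneity \<open>m \<le> bellman r w x A\<close> depends only on \<open>(x / m, A / m)\<close>, and this form of the
  condition exhibits it as the sublevel set of a convex function of that pair.\<close>
lemma le_bellman_iff:
  assumes "r > 0" "w > 0" "x > 0" "A > 0" "m > 0"
  shows "m \<le> bellman r w x A \<longleftrightarrow>
           w * (x / m) powr - r + carleson_weight r * (A / m) powr - r \<le> 1"
proof -
  define S where "S = w * x powr - r + carleson_weight r * A powr - r"
  have S: "S > 0" unfolding S_def
    using assms carleson_weight_pos[of r] by (intro add_pos_pos mult_pos_pos) auto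
  have "m \<le> bellman r w x A \<longleftrightarrow> m \<le> S powr (- 1 / r)"
    using assms by (simp add: bellman_def S_def)
  also have "\<dots> \<longleftrightarrow> S \<le> m powr - r"
  proof
    assume "m \<le> S powr (- 1 / r)"
    then have "(S powr (- 1 / r)) powr - r \<le> m powr - r"
      using assms by (intro powr_mono2') auto
    then show "S \<le> m powr - r" using assms S by (simp add: powr_powr)
  next
    assume "S \<le> m powr - r"
    then have "(m powr - r) powr (- 1 / r) \<le> S powr (- 1 / r)"
      using assms S by (intro powr_mono2') auto
    then show "m \<le> S powr (- 1 / r)" using assms by (simp add: powr_powr)
  qed
  also have "S \<le> m powr - r \<longleftrightarrow> S * m powr r \<le> 1"
    using assms by (simp add: powr_minus field_simps)
  also have "S * m powr r = w * (x / m) powr - r + carleson_weight r * (A / m) powr - r"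
    using assms by (simp add: S_def powr_divide powr_minus field_simps)
  finally show ?thesis .
qed

lemma bellman_scale:
  assumes "r > 0" "c > 0"
  shows "bellman r w (c * x) (c * A) = c * bellman r w x A"
proof (cases "x > 0 \<and> A > 0")
  case True
  have "w * (c * x) powr - r + carleson_weight r * (c * A) powr - r
      = c powr - r * (w * x powr - r + carleson_weight r * A powr - r)"
    using assms True by (simp add: powr_mult algebra_simps)
  then show ?thesis
    using assms True by (simp add: bellman_def powr_mult powr_powr)
qed (use assms in \<open>auto simp: bellman_def zero_less_mult_iff\<close>)

lemma bellman_mono:
  assumes "r > 0" "w > 0" "w' > 0" "w' \<le> w" "x \<le> x'" "A \<le> A'"
  shows "bellman r w x A \<le> bellman r w' x' A'"
proof (cases "x > 0 \<and> A > 0")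
  case True
  have "w' * x' powr - r \<le> w * x powr - r"
    using assms True by (intro mult_mono powr_mono2') auto
  moreover have "carleson_weight r * A' powr - r \<le> carleson_weight r * A powr - r"
    using assms True carleson_weight_pos[of r] by (intro mult_left_mono powr_mono2') auto
  moreover have "0 < w' * x' powr - r + carleson_weight r * A' powr - r"
    using assms True carleson_weight_pos[of r] by (intro add_pos_pos mult_pos_pos) auto
  ultimately show ?thesis
    using assms True by (auto simp: bellman_def intro!: powr_mono2')
qed (auto simp: bellman_def)

text \<open>A reverse Minkowski inequality. With \<open>m1\<close> and \<open>m2\<close> the two values on the left, the point
  \<open>((x1 + x2) / (m1 + m2), (A1 + A2) / (m1 + m2))\<close> is a convex combination of
  \<open>(x1 / m1, A1 / m1)\<close> and \<open>(x2 / m2, A2 / m2)\<close>. These two lie in the unit superlevel set, and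
  that set is convex because \<open>t powr - r\<close> is.\<close>
lemma bellman_superadditive:
  assumes r: "r > 0" and w: "w > 0" and nn: "0 \<le> x1" "0 \<le> A1" "0 \<le> x2" "0 \<le> A2"
  shows "bellman r w x1 A1 + bellman r w x2 A2 \<le> bellman r w (x1 + x2) (A1 + A2)"
proof (cases "x1 > 0 \<and> A1 > 0 \<and> x2 > 0 \<and> A2 > 0")
  case True
  then have pos: "x1 > 0" "A1 > 0" "x2 > 0" "A2 > 0" by auto
  define d where "d = carleson_weight r"
  have d: "d > 0" using carleson_weight_pos[OF r] by (simp add: d_def)
  define m1 m2 where "m1 = bellman r w x1 A1" and "m2 = bellman r w x2 A2"
  have m: "m1 > 0" "m2 > 0" using pos r w by (auto simp: m1_def m2_def bellman_pos)
  define s where "s = m1 / (m1 + m2)"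
  have s: "0 \<le> s" "s \<le> 1" and s': "1 - s = m2 / (m1 + m2)"
    using m by (auto simp: s_def field_simps)
  have conv: "((u + v) / (m1 + m2)) powr - r \<le> s * (u / m1) powr - r + (1 - s) * (v / m2) powr - r"
    if "u > 0" "v > 0" for u v
  proof -
    have "(u + v) / (m1 + m2) = s * (u / m1) + (1 - s) * (v / m2)"
      unfolding s' using m by (simp add: s_def add_divide_distrib)
    then show ?thesis
      using convex_onD[OF convex_on_powr_neg[of "- r"], of s "v / m2" "u / m1"] s m that r
      by (simp add: algebra_simps)
  qed
  have u1: "w * (x1 / m1) powr - r + d * (A1 / m1) powr - r \<le> 1"
    using le_bellman_iff[OF r w pos(1,2) m(1)] by (simp add: m1_def d_def)
  have u2: "w * (x2 / m2) powr - r + d * (A2 / m2) powr - r \<le> 1"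
    using le_bellman_iff[OF r w pos(3,4) m(2)] by (simp add: m2_def d_def)
  have "w * ((x1 + x2) / (m1 + m2)) powr - r + d * ((A1 + A2) / (m1 + m2)) powr - r
    \<le> w * (s * (x1 / m1) powr - r + (1 - s) * (x2 / m2) powr - r)
      + d * (s * (A1 / m1) powr - r + (1 - s) * (A2 / m2) powr - r)"
    using conv pos w d by (intro add_mono mult_left_mono) auto
  also have "\<dots> = s * (w * (x1 / m1) powr - r + d * (A1 / m1) powr - r)
      + (1 - s) * (w * (x2 / m2) powr - r + d * (A2 / m2) powr - r)"
    by (simp add: algebra_simps)
  also have "\<dots> \<le> s * 1 + (1 - s) * 1"
    using u1 u2 s by (intro add_mono mult_left_mono) auto
  finally have "m1 + m2 \<le> bellman r w (x1 + x2) (A1 + A2)"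
    using pos m by (subst le_bellman_iff[OF r w]) (auto simp: d_def)
  then show ?thesis by (simp add: m1_def m2_def)
next
  case False
  then have "bellman r w x1 A1 = 0 \<or> bellman r w x2 A2 = 0" by (auto simp: bellman_def)
  then show ?thesis
    using bellman_mono[OF r w w order_refl, of x1 "x1 + x2" A1 "A1 + A2"]
      bellman_mono[OF r w w order_refl, of x2 "x1 + x2" A2 "A1 + A2"] nn by auto
qed

text \<open>Concavity, in the form used when an interval is cut into its halves: averages and Carleson
  averages of the halves have the values of the parent as their means.\<close>
lemma bellman_midpoint:
  assumes "r > 0" "w > 0" "0 \<le> x1" "0 \<le> A1" "0 \<le> x2" "0 \<le> A2"
  shows "(bellman r w x1 A1 + bellman r w x2 A2) / 2 \<le> bellman r w ((x1 + x2) / 2) ((A1 + A2) / 2)"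
  using bellman_superadditive[OF assms] bellman_scale[of r "1/2" w "x1 + x2" "A1 + A2"] assms(1)
  by simp

text \<open>The cost of selecting an interval: it lowers the Carleson average of what remains by 1 and
  the missing power by \<open>x powr r\<close>. After division by \<open>x powr r\<close> the claim is
  \<open>d * ((A - 1) powr - r - A powr - r) \<ge> 1\<close>. The left side decreases in \<open>A\<close> and equals 1 at
  \<open>A = 2\<close>, which is where the Carleson constant enters.\<close>
lemma bellman_select:
  assumes r: "r > 0" and A: "1 \<le> A" "A \<le> 2" and x: "0 \<le> x" and w: "x powr r < w"
  shows "bellman r (w - x powr r) x (A - 1) \<le> bellman r w x A"
proof (cases "x > 0 \<and> A > 1")
  case True
  define d where "d = carleson_weight r"
  have d: "d > 0" using carleson_weight_pos[OF r] by (simp add: d_def)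
  have w0: "w > 0" using w powr_ge_zero[of x r] by linarith
  have xr: "x powr r * x powr - r = 1"
    using True by (simp add: powr_minus field_simps)
  have jump: "1 \<le> d * (A - 1) powr - r - d * A powr - r"
  proof -
    have p: "(2::real) powr r > 1" using r by simp
    have "d * (1 - 2 powr - r) = 1"
      using p r by (simp add: d_def carleson_weight_def powr_minus_divide divide_simps)
    then have "d * A powr - r + 1 = d * (A powr - r + (1 - 2 powr - r))"
      by (simp add: algebra_simps)
    also have "A powr - r + (1 - 2 powr - r) \<le> (A - 1) powr - r"
    proof -
      define h where "h t = (t - 1) powr - r - t powr - r" for t :: real
      have "h 2 \<le> h A"
      proof (rule DERIV_nonpos_imp_nonincreasing[OF A(2)])
        fix t assume t: "A \<le> t" "t \<le> 2"
        have t1: "t > 1" using True t by linarith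
        have D: "(h has_real_derivative
            (- r * (t - 1) powr (- r - 1) * 1 - - r * t powr (- r - 1))) (at t)"
          unfolding h_def using t1
          by (intro DERIV_diff DERIV_chain2[OF has_real_derivative_powr] has_real_derivative_powr)
             (auto intro!: derivative_eq_intros)
        have "t powr (- r - 1) \<le> (t - 1) powr (- r - 1)"
          using t1 r by (intro powr_mono2') auto
        then have "- r * (t - 1) powr (- r - 1) * 1 - - r * t powr (- r - 1) \<le> 0"
          using r by (simp add: mult_left_mono)
        then show "\<exists>y. DERIV h t :> y \<and> y \<le> 0" using D by blast
      qed
      then show ?thesis by (simp add: h_def)
    qed
    finally show ?thesis using d by simp
  qed
  have "w * x powr - r + d * A powr - r \<le> (w - x powr r) * x powr - r + d * (A - 1) powr - r"
    using jump xr by (simp add: algebra_simps)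
  moreover have "0 < w * x powr - r + d * A powr - r"
    using True w0 d by (intro add_pos_pos mult_pos_pos) auto
  ultimately show ?thesis
    using True r by (auto simp: bellman_def d_def intro!: powr_mono2')
qed (auto simp: bellman_def)

text \<open>Dropping the term in \<open>A\<close> loses nothing asymptotically as \<open>x\<close> tends to 0; this turns the
  Bellman bound into an estimate linear in \<open>x\<close>.\<close>
lemma bellman_le:
  assumes r: "r > 0" and w: "w > 0" and x: "0 \<le> x"
  shows "bellman r w x A \<le> x * w powr (- 1 / r)"
proof (cases "x > 0 \<and> A > 0")
  case True
  have "(w * x powr - r + carleson_weight r * A powr - r) powr (- 1 / r)
      \<le> (w * x powr - r) powr (- 1 / r)"
    using assms True carleson_weight_pos[OF r] by (intro powr_mono2') auto
  also have "\<dots> = x * w powr (- 1 / r)"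
    using assms True by (simp add: powr_mult powr_powr)
  finally show ?thesis using True by (simp add: bellman_def)
qed (use x in \<open>auto simp: bellman_def\<close>)

text \<open>A selected interval (hence \<open>A \<ge> 1\<close>) whose average already reaches the level may lie
  entirely in the level set. This fixes the factor \<open>(1 + d) powr (1 / r)\<close>: equality holds at
  \<open>A = 1\<close> and \<open>w = x powr r\<close>.\<close>
lemma bellman_terminal:
  assumes r: "r > 0" and w: "w > 0" and A: "1 \<le> A" and x: "0 \<le> x" "w \<le> x powr r"
  shows "1 \<le> (1 + carleson_weight r) powr (1 / r) * bellman r w x A"
proof -
  have x0: "x > 0" using x w by (cases "x = 0") auto
  define d where "d = carleson_weight r"
  have d: "d > 0" using carleson_weight_pos[OF r] by (simp add: d_def)
  have "w * x powr - r + d * A powr - r \<le> 1 + d * 1"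
  proof (intro add_mono mult_left_mono)
    show "w * x powr - r \<le> 1" using x x0 by (simp add: powr_minus field_simps)
    show "A powr - r \<le> 1" using A r powr_mono2'[of "- r" 1 A] by simp
  qed (use d in auto)
  moreover have "0 < w * x powr - r + d * A powr - r"
    using x0 w d A by (intro add_pos_pos mult_pos_pos) auto
  ultimately have "(1 + d) powr (- 1 / r) \<le> bellman r w x A"
    using x0 A r by (auto simp: bellman_def d_def intro!: powr_mono2')
  then have "(1 + d) powr (1 / r) * (1 + d) powr (- 1 / r) \<le> (1 + d) powr (1 / r) * bellman r w x A"
    using d by (intro mult_left_mono) auto
  then show ?thesis using d by (simp add: powr_add[symmetric] d_def)
qed

section \<open>Finitely many dyadic generations\<close>

definition dyadic_below :: "nat \<Rightarrow> real set \<Rightarrow> real set set" where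
  "dyadic_below n J = (\<Union>k<n. dyadic_gen k J)"

lemma dyadic_gen_Suc_halves:
  "dyadic_gen (Suc k) J = dyadic_gen k (left_half J) \<union> dyadic_gen k (right_half J)"
  by (induction k) auto

lemma dyadic_below_0 [simp]: "dyadic_below 0 J = {}"
  by (simp add: dyadic_below_def)

lemma dyadic_below_Suc:
  "dyadic_below (Suc n) J =
     insert J (dyadic_below n (left_half J) \<union> dyadic_below n (right_half J))"
proof -
  have "dyadic_below (Suc n) J = dyadic_gen 0 J \<union> (\<Union>k<n. dyadic_gen (Suc k) J)"
    by (simp add: dyadic_below_def lessThan_Suc_eq_insert_0 del: dyadic_gen.simps(2))
  then show ?thesis
    by (auto simp: dyadic_below_def dyadic_gen_Suc_halves simp del: dyadic_gen.simps(2))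
qed

lemma finite_dyadic_below [simp]: "finite (dyadic_below n J)"
proof -
  have "finite (dyadic_gen k J)" for k by (induction k) auto
  then show ?thesis by (simp add: dyadic_below_def)
qed

lemma dyadic_below_mono: "m \<le> n \<Longrightarrow> dyadic_below m J \<subseteq> dyadic_below n J"
  by (force simp: dyadic_below_def)

lemma dyadic_eq_UN_below: "dyadic J = (\<Union>n. dyadic_below n J)"
  by (auto simp: dyadic_def dyadic_below_def)

lemma dyadic_below_subset: "dyadic_below n J \<subseteq> dyadic J"
  by (auto simp: dyadic_eq_UN_below)

lemma self_in_dyadic: "J \<in> dyadic J"
  unfolding dyadic_def by (auto intro!: exI[of _ 0])

lemma dyadic_halves_subset: "dyadic (left_half J) \<union> dyadic (right_half J) \<subseteq> dyadic J"
  unfolding dyadic_def using dyadic_gen_Suc_halves by blast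

lemma dyadic_below_ivl:
  assumes "c < d" "K \<in> dyadic_below n {c..<d}"
  shows "\<exists>u v. K = {u..<v} \<and> u < v \<and> c \<le> u \<and> v \<le> d"
  using assms
proof (induction n arbitrary: c d)
  case (Suc n)
  have m: "c < (c + d) / 2" "(c + d) / 2 < d" using Suc.prems by auto
  from Suc.prems consider "K = {c..<d}" | "K \<in> dyadic_below n {c..<(c + d) / 2}"
    | "K \<in> dyadic_below n {(c + d) / 2..<d}"
    by (auto simp: dyadic_below_Suc left_half_ivl right_half_ivl)
  then show ?case
  proof cases
    case 2
    then show ?thesis using Suc.IH[OF m(1)] m by fastforce
  next
    case 3
    then show ?thesis using Suc.IH[OF m(2)] m by fastforce
  qed (use Suc.prems in auto)
qed auto

lemma dyadic_ivl:
  assumes "c < d" "K \<in> dyadic {c..<d}"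
  shows "\<exists>u v. K = {u..<v} \<and> u < v \<and> c \<le> u \<and> v \<le> d"
  using assms dyadic_below_ivl by (auto simp: dyadic_eq_UN_below)

lemma dyadic_subset:
  assumes "c < d" "K \<in> dyadic {c..<d}"
  shows "K \<subseteq> {c..<d}"
  using dyadic_ivl[OF assms] by auto

lemma dyadic_trans:
  assumes "K \<in> dyadic J" "J \<in> dyadic I"
  shows "K \<in> dyadic I"
proof -
  have *: "J \<in> dyadic_gen k I \<Longrightarrow> K \<in> dyadic I" for k
    using assms(1)
  proof (induction k arbitrary: I)
    case (Suc k)
    then show ?case using dyadic_halves_subset[of I]
      unfolding dyadic_gen_Suc_halves by blast
  qed auto
  then show ?thesis using assms(2) unfolding dyadic_def by blast
qed

text \<open>The top interval and the two subtrees share no interval, so sums over the first generations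
  obey the recursion along which the Bellman induction runs.\<close>
lemma sum_dyadic_below_Suc:
  fixes F :: "real set \<Rightarrow> 'a :: comm_monoid_add"
  assumes cd: "c < d"
  shows "(\<Sum>K\<in>dyadic_below (Suc n) {c..<d}. F K) =
    F {c..<d} + ((\<Sum>K\<in>dyadic_below n {c..<(c + d) / 2}. F K)
              + (\<Sum>K\<in>dyadic_below n {(c + d) / 2..<d}. F K))"
proof -
  let ?L = "dyadic_below n {c..<(c + d) / 2}" and ?R = "dyadic_below n {(c + d) / 2..<d}"
  have m: "c < (c + d) / 2" "(c + d) / 2 < d" using cd by auto
  have L: "\<exists>u v. K = {u..<v} \<and> u < v \<and> c \<le> u \<and> v \<le> (c + d) / 2" if "K \<in> ?L" for K
    using dyadic_below_ivl[OF m(1) that] .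
  have R: "\<exists>u v. K = {u..<v} \<and> u < v \<and> (c + d) / 2 \<le> u \<and> v \<le> d" if "K \<in> ?R" for K
    using dyadic_below_ivl[OF m(2) that] .
  have "?L \<inter> ?R = {}"
  proof (rule equals0I)
    fix K assume "K \<in> ?L \<inter> ?R"
    then have "K \<in> ?L" "K \<in> ?R" by auto
    from L[OF this(1)] obtain u v where "K = {u..<v}" "u < v" "v \<le> (c + d) / 2" by blast
    moreover from R[OF \<open>K \<in> ?R\<close>] obtain u' v' where "K = {u'..<v'}" "u' < v'" "(c + d) / 2 \<le> u'"
      by blast
    ultimately show False using atLeastLessThan_eq_iff[of u v u' v'] by auto
  qed
  moreover have "{c..<d} \<notin> ?L \<union> ?R"
  proof
    assume "{c..<d} \<in> ?L \<union> ?R"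
    then show False
    proof
      assume "{c..<d} \<in> ?L"
      from L[OF this] show False using cd m by (auto simp: atLeastLessThan_eq_iff)
    next
      assume "{c..<d} \<in> ?R"
      from R[OF this] show False using cd m by (auto simp: atLeastLessThan_eq_iff)
    qed
  qed
  ultimately show ?thesis
    using cd by (simp add: dyadic_below_Suc left_half_ivl right_half_ivl sum.union_disjoint)
qed

text \<open>Every finite set of dyadic intervals lies in finitely many generations.\<close>

lemma infsum_dyadic:
  fixes F :: "real set \<Rightarrow> ennreal"
  shows "(\<Sum>\<^sub>\<infinity>K\<in>dyadic J. F K) = (SUP n. \<Sum>K\<in>dyadic_below n J. F K)"
proof -
  have "(\<Sum>\<^sub>\<infinity>K\<in>dyadic J. F K) = (SUP X\<in>{X. finite X \<and> X \<subseteq> dyadic J}. sum F X)"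
    by (rule nonneg_infsum_complete) simp
  also have "\<dots> = (SUP n. \<Sum>K\<in>dyadic_below n J. F K)"
  proof (rule SUP_eq)
    fix X assume "X \<in> {X. finite X \<and> X \<subseteq> dyadic J}"
    then have "finite X" "X \<subseteq> \<Union>(range (\<lambda>n. dyadic_below n J))" by (auto simp: dyadic_eq_UN_below)
    moreover have "subset.chain UNIV (range (\<lambda>n. dyadic_below n J))"
    proof -
      have "dyadic_below m J \<subseteq> dyadic_below n J \<or> dyadic_below n J \<subseteq> dyadic_below m J" for m n
        using dyadic_below_mono[of m n J] dyadic_below_mono[of n m J] by linarith
      then show ?thesis by (auto simp: subset_chain_def)
    qed
    ultimately obtain n where "X \<subseteq> dyadic_below n J"
      using finite_subset_Union_chain[of X "range (\<lambda>n. dyadic_below n J)" UNIV] by blast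
    then show "\<exists>n\<in>UNIV. sum F X \<le> (\<Sum>K\<in>dyadic_below n J. F K)"
      by (auto intro!: sum_mono2)
  next
    fix n :: nat
    show "\<exists>X\<in>{X. finite X \<and> X \<subseteq> dyadic J}. (\<Sum>K\<in>dyadic_below n J. F K) \<le> sum F X"
      by (rule bexI[of _ "dyadic_below n J"]) (auto simp: dyadic_eq_UN_below)
  qed
  finally show ?thesis .
qed

section \<open>The weak-type estimate over finitely many generations\<close>

definition partial_carleson :: "(real set \<Rightarrow> real) \<Rightarrow> nat \<Rightarrow> real set \<Rightarrow> real" where
  "partial_carleson \<alpha> n J = (\<Sum>K\<in>dyadic_below n J. \<alpha> K * measure lebesgue K) / measure lebesgue J"

text \<open>The sum inside the operator, over \<open>n\<close> generations and before the root is taken. The averages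
  enter as an arbitrary function \<open>x\<close> of intervals: the induction needs only that they are
  nonnegative and that the value of an interval is the mean of the values of its halves.\<close>
definition partial_sparse ::
  "(real set \<Rightarrow> real) \<Rightarrow> (real set \<Rightarrow> real) \<Rightarrow> real \<Rightarrow> nat \<Rightarrow> real set \<Rightarrow> real \<Rightarrow> real" where
  "partial_sparse \<alpha> x r n J t = (\<Sum>K\<in>dyadic_below n J. \<alpha> K * x K powr r * indicator K t)"

lemma atLeastLessThan_lmeasurable: "{u..<v :: real} \<in> lmeasurable"
  by (rule bounded_set_imp_lmeasurable, rule bounded_subset[of "{u..v}"]) auto

lemma partial_carleson_Suc:
  assumes "c < d"
  shows "partial_carleson \<alpha> (Suc n) {c..<d} = \<alpha> {c..<d}
    + (partial_carleson \<alpha> n {c..<(c + d) / 2} + partial_carleson \<alpha> n {(c + d) / 2..<d}) / 2"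
proof -
  have len: "measure lebesgue {c..<(c + d) / 2} = (d - c) / 2"
    "measure lebesgue {(c + d) / 2..<d} = (d - c) / 2" "measure lebesgue {c..<d} = d - c"
    using assms by (auto simp: field_simps)
  have "(p * l + (u + v)) / l = p + (u / (l / 2) + v / (l / 2)) / 2" if "l \<noteq> 0" for l p u v :: real
    using that by (simp add: field_simps)
  then show ?thesis
    unfolding partial_carleson_def sum_dyadic_below_Suc[OF assms] len using assms by auto
qed

lemma partial_carleson_nonneg:
  assumes "\<And>K. K \<in> dyadic J \<Longrightarrow> \<alpha> K \<in> {0, 1}"
  shows "0 \<le> partial_carleson \<alpha> n J"
proof -
  have "0 \<le> \<alpha> K" if "K \<in> dyadic_below n J" for K
    using assms[of K] that by (fastforce simp: dyadic_eq_UN_below)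
  then show ?thesis
    unfolding partial_carleson_def by (intro divide_nonneg_nonneg sum_nonneg mult_nonneg_nonneg) auto
qed

lemma partial_sparse_outside:
  assumes "c < d" "t \<notin> {c..<d}"
  shows "partial_sparse \<alpha> x r n {c..<d} t = 0"
  unfolding partial_sparse_def
proof (intro sum.neutral ballI)
  fix K assume "K \<in> dyadic_below n {c..<d}"
  then have "t \<notin> K" using dyadic_below_ivl[OF assms(1)] assms(2) by fastforce
  then show "\<alpha> K * x K powr r * indicator K t = 0" by simp
qed

lemma partial_sparse_Suc:
  assumes "c < d" "t \<in> {c..<d}"
  shows "partial_sparse \<alpha> x r (Suc n) {c..<d} t = \<alpha> {c..<d} * x {c..<d} powr r
    + (if t < (c + d) / 2 then partial_sparse \<alpha> x r n {c..<(c + d) / 2} t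
       else partial_sparse \<alpha> x r n {(c + d) / 2..<d} t)"
proof -
  have m: "c < (c + d) / 2" "(c + d) / 2 < d" using assms by auto
  have "partial_sparse \<alpha> x r (Suc n) {c..<d} t = \<alpha> {c..<d} * x {c..<d} powr r
    + (partial_sparse \<alpha> x r n {c..<(c + d) / 2} t + partial_sparse \<alpha> x r n {(c + d) / 2..<d} t)"
    using assms unfolding partial_sparse_def sum_dyadic_below_Suc[OF assms(1)] by simp
  then show ?thesis
    using partial_sparse_outside[OF m(1), of t] partial_sparse_outside[OF m(2), of t] by auto
qed

lemma partial_sparse_measurable:
  assumes "c < d"
  shows "partial_sparse \<alpha> x r n {c..<d} \<in> borel_measurable borel"
proof -
  have "K \<in> sets borel" if "K \<in> dyadic_below n {c..<d}" for K
    using dyadic_below_ivl[OF assms that] by auto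
  then have "(\<lambda>t. \<alpha> K * x K powr r * indicator K t) \<in> borel_measurable borel"
    if "K \<in> dyadic_below n {c..<d}" for K
    using that by (intro borel_measurable_times borel_measurable_const borel_measurable_indicator)
  then show ?thesis
    unfolding partial_sparse_def by (rule borel_measurable_sum)
qed

lemma partial_sparse_level_lmeasurable:
  assumes "c < d"
  shows "{t \<in> {c..<d}. w \<le> partial_sparse \<alpha> x r n {c..<d} t} \<in> lmeasurable"
proof -
  note [measurable] = partial_sparse_measurable[OF assms, of \<alpha> x r n]
  have "{t \<in> {c..<d}. w \<le> partial_sparse \<alpha> x r n {c..<d} t} \<in> sets borel"
    by measurable
  moreover have "bounded {t \<in> {c..<d}. w \<le> partial_sparse \<alpha> x r n {c..<d} t}"
    by (rule bounded_subset[of "{c..d}"]) auto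
  ultimately show ?thesis by (intro bounded_set_imp_lmeasurable) auto
qed

text \<open>The Bellman induction on the number of generations. If the top interval is selected, then the
  level \<open>w\<close> drops to \<open>v = w - x J powr r\<close> and the mean of the Carleson averages of the halves is
  \<open>A - 1\<close>. The hypothesis for the halves, concavity and the selection inequality bring the
  estimate back to \<open>(w, x J, A)\<close>. Once \<open>v \<le> 0\<close>, the whole interval may be in the level set, and
  the terminal inequality pays for it.\<close>
lemma measure_partial_sparse_level_le:
  fixes \<alpha> x :: "real set \<Rightarrow> real"
  assumes r: "r > 0" and cd: "c < d" and w: "w > 0"
    and nonneg: "\<And>J. J \<in> dyadic {c..<d} \<Longrightarrow> 0 \<le> x J"
    and mid: "\<And>u v. u < v \<Longrightarrow> {u..<v} \<in> dyadic {c..<d} \<Longrightarrow>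
           x {u..<v} = (x {u..<(u + v) / 2} + x {(u + v) / 2..<v}) / 2"
    and bin: "\<And>J. J \<in> dyadic {c..<d} \<Longrightarrow> \<alpha> J \<in> {0, 1}"
    and carl: "\<And>J m. J \<in> dyadic {c..<d} \<Longrightarrow> partial_carleson \<alpha> m J \<le> 2"
  shows "measure lebesgue {t \<in> {c..<d}. w \<le> partial_sparse \<alpha> x r n {c..<d} t}
    \<le> (d - c) * ((1 + carleson_weight r) powr (1 / r)
        * bellman r w (x {c..<d}) (partial_carleson \<alpha> n {c..<d}))"
  using cd w nonneg mid bin carl
proof (induction n arbitrary: c d w)
  case 0
  have "{t \<in> {c..<d}. w \<le> partial_sparse \<alpha> x r 0 {c..<d} t} = {}"
    using \<open>w > 0\<close> by (auto simp: partial_sparse_def)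
  moreover have "0 \<le> (d - c) * ((1 + carleson_weight r) powr (1 / r)
      * bellman r w (x {c..<d}) (partial_carleson \<alpha> 0 {c..<d}))"
    using \<open>c < d\<close> by (intro mult_nonneg_nonneg bellman_nonneg powr_ge_zero) simp
  ultimately show ?case by (simp only: measure_empty)
next
  case (Suc n)
  note cd = \<open>c < d\<close> and w = \<open>w > 0\<close>
  define m where "m = (c + d) / 2"
  define J L R where "J = {c..<d}" and "L = {c..<m}" and "R = {m..<d}"
  define C where "C = (1 + carleson_weight r) powr (1 / r)"
  have m: "c < m" "m < d" "m - c = (d - c) / 2" "d - m = (d - c) / 2"
    using cd by (auto simp: m_def field_simps)
  have JD: "J \<in> dyadic J" by (rule self_in_dyadic)
  have sub: "dyadic L \<subseteq> dyadic J" "dyadic R \<subseteq> dyadic J"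
    using dyadic_halves_subset[of "{c..<d}"] left_half_ivl[OF cd] right_half_ivl[OF cd]
    by (auto simp: J_def L_def R_def m_def)
  note nonneg = Suc.prems(3)[folded J_def] and mid = Suc.prems(4)[folded J_def]
    and bin = Suc.prems(5)[folded J_def] and carl = Suc.prems(6)[folded J_def]
  define AL AR where "AL = partial_carleson \<alpha> n L" and "AR = partial_carleson \<alpha> n R"
  define A where "A = partial_carleson \<alpha> (Suc n) J"
  have A: "A = \<alpha> J + (AL + AR) / 2"
    unfolding A_def AL_def AR_def J_def L_def R_def m_def by (rule partial_carleson_Suc[OF cd])
  have A_nonneg: "0 \<le> AL" "0 \<le> AR"
    unfolding AL_def AR_def using bin sub by (auto intro!: partial_carleson_nonneg)
  have A2: "A \<le> 2" unfolding A_def by (rule carl[OF JD])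
  have xJ: "x J = (x L + x R) / 2"
    using mid[OF cd] JD by (simp add: J_def L_def R_def m_def)
  have x_nonneg: "0 \<le> x J" "0 \<le> x L" "0 \<le> x R"
    using nonneg JD sub self_in_dyadic by blast+
  define E where "E v K = {t \<in> K. v \<le> partial_sparse \<alpha> x r n K t}" for v K
  have IHL: "measure lebesgue (E v L) \<le> (m - c) * (C * bellman r v (x L) AL)" if "v > 0" for v
    unfolding E_def L_def C_def AL_def
  proof (rule Suc.IH[OF m(1) that])
    note S = subsetD[OF sub(1)[unfolded L_def]]
    show "0 \<le> x K" if "K \<in> dyadic {c..<m}" for K by (rule nonneg[OF S[OF that]])
    show "x {p..<q} = (x {p..<(p + q) / 2} + x {(p + q) / 2..<q}) / 2"
      if "p < q" "{p..<q} \<in> dyadic {c..<m}" for p q by (rule mid[OF that(1) S[OF that(2)]])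
    show "\<alpha> K \<in> {0, 1}" if "K \<in> dyadic {c..<m}" for K by (rule bin[OF S[OF that]])
    show "partial_carleson \<alpha> k K \<le> 2" if "K \<in> dyadic {c..<m}" for K k
      by (rule carl[OF S[OF that]])
  qed
  have IHR: "measure lebesgue (E v R) \<le> (d - m) * (C * bellman r v (x R) AR)" if "v > 0" for v
    unfolding E_def R_def C_def AR_def
  proof (rule Suc.IH[OF m(2) that])
    note S = subsetD[OF sub(2)[unfolded R_def]]
    show "0 \<le> x K" if "K \<in> dyadic {m..<d}" for K by (rule nonneg[OF S[OF that]])
    show "x {p..<q} = (x {p..<(p + q) / 2} + x {(p + q) / 2..<q}) / 2"
      if "p < q" "{p..<q} \<in> dyadic {m..<d}" for p q by (rule mid[OF that(1) S[OF that(2)]])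
    show "\<alpha> K \<in> {0, 1}" if "K \<in> dyadic {m..<d}" for K by (rule bin[OF S[OF that]])
    show "partial_carleson \<alpha> k K \<le> 2" if "K \<in> dyadic {m..<d}" for K k
      by (rule carl[OF S[OF that]])
  qed
  define v where "v = w - \<alpha> J * x J powr r"
  have split: "{t \<in> J. w \<le> partial_sparse \<alpha> x r (Suc n) J t} = E v L \<union> E v R"
  proof -
    have "partial_sparse \<alpha> x r (Suc n) J t = \<alpha> J * x J powr r
      + (if t < m then partial_sparse \<alpha> x r n L t else partial_sparse \<alpha> x r n R t)" if "t \<in> J" for t
      using that unfolding J_def L_def R_def m_def by (rule partial_sparse_Suc[OF cd])
    then have "w \<le> partial_sparse \<alpha> x r (Suc n) J t \<longleftrightarrow>
      v \<le> (if t < m then partial_sparse \<alpha> x r n L t else partial_sparse \<alpha> x r n R t)" if "t \<in> J" for t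
      using that by (auto simp: v_def)
    moreover have "J = L \<union> R" "\<And>t. t \<in> L \<Longrightarrow> t < m" "\<And>t. t \<in> R \<Longrightarrow> \<not> t < m"
      using m by (auto simp: J_def L_def R_def)
    ultimately show ?thesis by (auto simp: E_def)
  qed
  have lm: "E v L \<in> lmeasurable" "E v R \<in> lmeasurable"
    unfolding E_def L_def R_def by (rule partial_sparse_level_lmeasurable[OF m(1)],
      rule partial_sparse_level_lmeasurable[OF m(2)])
  show ?case
    unfolding J_def[symmetric] C_def[symmetric] A_def[symmetric] split
  proof (cases "v > 0")
    case True
    have "measure lebesgue (E v L \<union> E v R) \<le> measure lebesgue (E v L) + measure lebesgue (E v R)"
      using lm by (intro measure_Un_le) auto
    also have "\<dots> \<le> (m - c) * (C * bellman r v (x L) AL) + (d - m) * (C * bellman r v (x R) AR)"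
      by (intro add_mono IHL IHR True)
    also have "\<dots> = (d - c) * (C * ((bellman r v (x L) AL + bellman r v (x R) AR) / 2))"
      unfolding m(3,4) by (simp add: field_simps)
    also have "\<dots> \<le> (d - c) * (C * bellman r v (x J) ((AL + AR) / 2))"
      unfolding xJ using cd r True x_nonneg A_nonneg
      by (intro mult_left_mono bellman_midpoint) (auto simp: C_def)
    also have "\<dots> \<le> (d - c) * (C * bellman r w (x J) A)"
    proof -
      have "bellman r v (x J) ((AL + AR) / 2) \<le> bellman r w (x J) A"
      proof (cases "\<alpha> J = 0")
        case True
        then show ?thesis by (simp add: v_def A)
      next
        case False
        then have "\<alpha> J = 1" using bin[OF JD] by simp
        then show ?thesis
          using bellman_select[of r A "x J" w] r A2 x_nonneg(1) True A_nonneg by (simp add: v_def A)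
      qed
      then show ?thesis using cd by (intro mult_left_mono) (auto simp: C_def)
    qed
    finally show "measure lebesgue (E v L \<union> E v R) \<le> (d - c) * (C * bellman r w (x J) A)" .
  next
    case False
    then have "\<alpha> J = 1" using bin[OF JD] w by (auto simp: v_def)
    with False have "w \<le> x J powr r" "1 \<le> A" using A_nonneg by (auto simp: v_def A)
    then have "1 \<le> C * bellman r w (x J) A"
      unfolding C_def using r w x_nonneg by (intro bellman_terminal)
    moreover have "measure lebesgue (E v L \<union> E v R) \<le> d - c"
    proof -
      have "measure lebesgue (E v L \<union> E v R) \<le> measure lebesgue {c..<d}"
        using lm m by (intro measure_mono_fmeasurable) (auto simp: E_def L_def R_def intro: atLeastLessThan_lmeasurable)
      then show ?thesis using cd by simp
    qed
    moreover from calculation have "(d - c) * 1 \<le> (d - c) * (C * bellman r w (x J) A)"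
      using cd by (intro mult_left_mono) auto
    ultimately show "measure lebesgue (E v L \<union> E v R) \<le> (d - c) * (C * bellman r w (x J) A)"
      by (metis mult.right_neutral order_trans)
  qed
qed

section \<open>From generations to the full operator\<close>

text \<open>The extended nonnegative averages in the definition are suprema of real truncated ones, so
  membership becomes a family of real inequalities.\<close>
lemma two_carleson_seqs_iff:
  assumes "a < b"
  shows "\<alpha> \<in> two_carleson_seqs {a..<b} \<longleftrightarrow>
    (\<forall>J\<in>dyadic {a..<b}. \<alpha> J \<in> {0, 1} \<and> (\<forall>n. partial_carleson \<alpha> n J \<le> 2))"
proof -
  have "carleson_avg \<alpha> J \<le> 2 \<longleftrightarrow> (\<forall>n. partial_carleson \<alpha> n J \<le> 2)"
    if bin: "\<forall>J\<in>dyadic {a..<b}. \<alpha> J \<in> {0, 1}" and J: "J \<in> dyadic {a..<b}" for J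
  proof -
    obtain u v where uv: "J = {u..<v}" "u < v" using dyadic_ivl[OF assms J] by blast
    have nn: "0 \<le> \<alpha> K" if "K \<in> dyadic J" for K
      using bin dyadic_trans[OF that J] by fastforce
    have fin: "emeasure lebesgue K = ennreal (measure lebesgue K)" if "K \<in> dyadic J" for K
      using dyadic_ivl[of u v K] uv that by auto
    have "(\<Sum>K\<in>dyadic_below n J. ennreal (\<alpha> K) * emeasure lebesgue K)
        = ennreal (\<Sum>K\<in>dyadic_below n J. \<alpha> K * measure lebesgue K)" for n
    proof -
      have "(\<Sum>K\<in>dyadic_below n J. ennreal (\<alpha> K) * emeasure lebesgue K)
          = (\<Sum>K\<in>dyadic_below n J. ennreal (\<alpha> K * measure lebesgue K))"
        using nn fin subsetD[OF dyadic_below_subset]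
        by (intro sum.cong refl) (metis ennreal_mult measure_nonneg)
      also have "\<dots> = ennreal (\<Sum>K\<in>dyadic_below n J. \<alpha> K * measure lebesgue K)"
        using nn subsetD[OF dyadic_below_subset] by (intro sum_ennreal mult_nonneg_nonneg) auto
      finally show ?thesis .
    qed
    then have "carleson_avg \<alpha> J =
        (SUP n. ennreal (\<Sum>K\<in>dyadic_below n J. \<alpha> K * measure lebesgue K)) / ennreal (v - u)"
      using uv by (simp add: carleson_avg_def infsum_dyadic)
    also have "\<dots> = (SUP n. ennreal (\<Sum>K\<in>dyadic_below n J. \<alpha> K * measure lebesgue K) / ennreal (v - u))"
      by (rule SUP_divide_ennreal)
    also have "\<dots> = (SUP n. ennreal (partial_carleson \<alpha> n J))"
    proof (rule SUP_cong)
      fix n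
      have "0 \<le> (\<Sum>K\<in>dyadic_below n J. \<alpha> K * measure lebesgue K)"
        using nn subsetD[OF dyadic_below_subset] by (intro sum_nonneg mult_nonneg_nonneg) auto
      then show "ennreal (\<Sum>K\<in>dyadic_below n J. \<alpha> K * measure lebesgue K) / ennreal (v - u)
          = ennreal (partial_carleson \<alpha> n J)"
        using uv by (simp add: partial_carleson_def divide_ennreal)
    qed simp
    also have "\<dots> \<le> 2 \<longleftrightarrow> (\<forall>n. partial_carleson \<alpha> n J \<le> 2)"
      by (simp add: SUP_le_iff flip: ennreal_numeral)
    finally show ?thesis .
  qed
  then show ?thesis
    unfolding two_carleson_seqs_def binary_seq_def by (auto simp: SUP_le_iff)
qed

lemma ennreal_le_powr_inverse_iff:
  assumes "r > 0" "l > 0"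
  shows "ennreal l \<le> ennreal_powr y (1 / r) \<longleftrightarrow> ennreal (l powr r) \<le> y"
proof (cases y)
  case (real z)
  have "l \<le> z powr (1 / r) \<longleftrightarrow> l powr r \<le> z"
  proof
    assume "l \<le> z powr (1 / r)"
    then have "l powr r \<le> (z powr (1 / r)) powr r"
      using assms by (intro powr_mono2) auto
    then show "l powr r \<le> z" using assms real by (simp add: powr_powr)
  next
    assume "l powr r \<le> z"
    then have "(l powr r) powr (1 / r) \<le> z powr (1 / r)"
      using assms by (intro powr_mono2) auto
    then show "l \<le> z powr (1 / r)" using assms by (simp add: powr_powr)
  qed
  then show ?thesis using real by (simp add: ennreal_powr_def)
qed (simp add: ennreal_powr_def)

lemma sparse_op_ge_iff:
  assumes "\<And>J. J \<in> dyadic I \<Longrightarrow> \<alpha> J \<in> {0, 1}" "r > 0" "l > 0"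
  shows "ennreal l \<le> sparse_op I \<alpha> r f t \<longleftrightarrow>
    ennreal (l powr r) \<le> (SUP n. ennreal (partial_sparse \<alpha> (average (\<lambda>x. \<bar>f x\<bar>)) r n I t))"
proof -
  have nn: "0 \<le> \<alpha> K" if "K \<in> dyadic I" for K
    using assms(1)[OF that] by auto
  have "(\<Sum>K\<in>dyadic_below n I. ennreal (\<alpha> K * average (\<lambda>x. \<bar>f x\<bar>) K powr r * indicator K t))
      = ennreal (partial_sparse \<alpha> (average (\<lambda>x. \<bar>f x\<bar>)) r n I t)" for n
    unfolding partial_sparse_def using nn
    by (intro sum_ennreal mult_nonneg_nonneg) (auto simp: dyadic_eq_UN_below)
  then show ?thesis
    unfolding sparse_op_def infsum_dyadic ennreal_le_powr_inverse_iff[OF assms(2,3)] by simp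
qed

lemma sparse_op_level_borel:
  assumes "\<And>J. J \<in> dyadic {a..<b} \<Longrightarrow> \<alpha> J \<in> {0, 1}" "r > 0" "l > 0" "a < b"
  shows "{t \<in> {a..<b}. ennreal l \<le> sparse_op {a..<b} \<alpha> r f t} \<in> sets borel"
proof -
  note [measurable] = partial_sparse_measurable[OF assms(4), of \<alpha> "average (\<lambda>x. \<bar>f x\<bar>)" r]
  have "{t \<in> {a..<b}. ennreal (l powr r) \<le>
    (SUP n. ennreal (partial_sparse \<alpha> (average (\<lambda>x. \<bar>f x\<bar>)) r n {a..<b} t))} \<in> sets borel"
    by measurable
  then show ?thesis using assms(1-3) by (simp add: sparse_op_ge_iff)
qed

lemma average_midpoint:
  assumes "set_integrable lebesgue {u..<v} g" "u < v"
  shows "average g {u..<v} = (average g {u..<(u + v) / 2} + average g {(u + v) / 2..<v}) / 2"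
proof -
  define m where "m = (u + v) / 2"
  have m: "u < m" "m < v" "m - u = (v - u) / 2" "v - m = (v - u) / 2"
    using assms by (auto simp: m_def field_simps)
  have un: "{u..<v} = {u..<m} \<union> {m..<v}" using m by auto
  have "(LINT t:{u..<v}|lebesgue. g t) = (LINT t:{u..<m}|lebesgue. g t) + (LINT t:{m..<v}|lebesgue. g t)"
    unfolding un using m
    by (intro set_integral_Un set_integrable_subset[OF assms(1)]) auto
  moreover have "measure lebesgue {u..<m} = (v - u) / 2" "measure lebesgue {m..<v} = (v - u) / 2"
    "measure lebesgue {u..<v} = v - u"
    using m assms by auto
  moreover have "1 / l * (p + q) = (1 / (l / 2) * p + 1 / (l / 2) * q) / 2" for l p q :: real
    by (simp add: add_divide_distrib)
  ultimately show ?thesis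
    unfolding average_def m_def[symmetric] by metis
qed

lemma average_nonneg: "0 \<le> average (\<lambda>x. \<bar>f x\<bar>) J"
  by (auto simp: average_def set_lebesgue_integral_def intro!: integral_nonneg mult_nonneg_nonneg)

text \<open>The bound over finitely many generations passes to the limit only through a slightly smaller
  level, because a supremum can reach \<open>l powr r\<close> without any partial sum doing so. Hence the level
  \<open>z * l\<close> with \<open>z < 1\<close>, and \<open>z\<close> tending to 1.\<close>
lemma sparse_op_weak_type:
  assumes ab: "a < b" and r: "r > 0" and l: "l > 0"
    and \<alpha>: "\<alpha> \<in> two_carleson_seqs {a..<b}" and f: "set_integrable lebesgue {a..<b} f"
  shows "emeasure lebesgue {t \<in> {a..<b}. ennreal l \<le> sparse_op {a..<b} \<alpha> r f t}
    \<le> ennreal ((1 + carleson_weight r) powr (1 / r) / l * (LINT t:{a..<b}|lebesgue. \<bar>f t\<bar>))"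
proof -
  define I where "I = {a..<b}"
  define x where "x = average (\<lambda>t. \<bar>f t\<bar>)"
  define C where "C = (1 + carleson_weight r) powr (1 / r)"
  define E where "E = {t \<in> I. ennreal l \<le> sparse_op I \<alpha> r f t}"
  have bin: "\<And>J. J \<in> dyadic I \<Longrightarrow> \<alpha> J \<in> {0, 1}"
    and carl: "\<And>J n. J \<in> dyadic I \<Longrightarrow> partial_carleson \<alpha> n J \<le> 2"
    using \<alpha> unfolding I_def two_carleson_seqs_iff[OF ab] by blast+
  have E: "E \<in> lmeasurable"
  proof (rule bounded_set_imp_lmeasurable)
    show "bounded E" by (rule bounded_subset[of "{a..b}"]) (auto simp: E_def I_def)
    have "E \<in> sets borel"
      unfolding E_def I_def by (rule sparse_op_level_borel[OF bin[unfolded I_def] r l ab])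
    then show "E \<in> sets lebesgue" by auto
  qed
  have mid: "x {u..<v} = (x {u..<(u + v) / 2} + x {(u + v) / 2..<v}) / 2"
    if "u < v" "{u..<v} \<in> dyadic I" for u v
  proof -
    have "{u..<v} \<subseteq> I" using that(2) unfolding I_def by (rule dyadic_subset[OF ab])
    then have "set_integrable lebesgue {u..<v} (\<lambda>t. \<bar>f t\<bar>)"
      using f by (intro set_integrable_abs set_integrable_subset[OF f]) (auto simp: I_def)
    then show ?thesis unfolding x_def using that(1) by (rule average_midpoint)
  qed
  have level: "measure lebesgue {t \<in> I. w \<le> partial_sparse \<alpha> x r n I t} \<le> (b - a) * (C * (x I * w powr (- 1 / r)))"
    if "w > 0" for n w
  proof -
    have "measure lebesgue {t \<in> I. w \<le> partial_sparse \<alpha> x r n I t}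
      \<le> (b - a) * (C * bellman r w (x I) (partial_carleson \<alpha> n I))"
      unfolding I_def C_def
    proof (rule measure_partial_sparse_level_le[OF r ab that])
      show "0 \<le> x J" for J unfolding x_def by (rule average_nonneg)
    qed (fact mid[unfolded I_def] bin[unfolded I_def] carl[unfolded I_def])+
    also have "\<dots> \<le> (b - a) * (C * (x I * w powr (- 1 / r)))"
      using ab by (intro mult_left_mono bellman_le r that) (auto simp: C_def x_def average_nonneg)
    finally show ?thesis .
  qed
  have "z * measure lebesgue E \<le> C / l * (LINT t:I|lebesgue. \<bar>f t\<bar>)" if z: "0 < z" "z < 1" for z :: real
  proof -
    define w where "w = (z * l) powr r"
    have w: "w > 0" "w < l powr r"
      using z l r by (auto simp: w_def intro!: powr_less_mono2)
    have w_inv: "w powr (- 1 / r) = 1 / (z * l)"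
      using z l r by (simp add: w_def powr_powr powr_minus field_simps)
    define G where "G n = {t \<in> I. w \<le> partial_sparse \<alpha> x r n I t}" for n
    have G: "G n \<in> lmeasurable" for n
      unfolding G_def I_def by (rule partial_sparse_level_lmeasurable[OF ab])
    have "incseq G"
    proof (rule monoI)
      fix m n :: nat assume "m \<le> n"
      then have "partial_sparse \<alpha> x r m I t \<le> partial_sparse \<alpha> x r n I t" for t
        unfolding partial_sparse_def using dyadic_below_mono[of m n I] bin
        by (intro sum_mono2) (fastforce simp: dyadic_eq_UN_below)+
      then show "G m \<subseteq> G n" unfolding G_def using order_trans by blast
    qed
    have UG: "(\<Union>n. G n) \<in> lmeasurable"
    proof (rule bounded_set_imp_lmeasurable)
      show "bounded (\<Union>n. G n)" by (rule bounded_subset[of "{a..b}"]) (auto simp: G_def I_def)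
      show "(\<Union>n. G n) \<in> sets lebesgue" using G by (intro sets.countable_UN) auto
    qed
    have "E \<subseteq> (\<Union>n. G n)"
    proof
      fix t assume t: "t \<in> E"
      have "ennreal w < ennreal (l powr r)" using w by (simp add: ennreal_less_iff)
      also have "\<dots> \<le> (SUP n. ennreal (partial_sparse \<alpha> x r n I t))"
        using t bin r l unfolding E_def x_def by (simp add: sparse_op_ge_iff)
      finally obtain n where "ennreal w < ennreal (partial_sparse \<alpha> x r n I t)"
        by (auto simp: less_SUP_iff)
      then have "w \<le> partial_sparse \<alpha> x r n I t" using w by (simp add: ennreal_less_iff)
      then show "t \<in> (\<Union>n. G n)" using t by (auto simp: G_def E_def)
    qed
    then have "measure lebesgue E \<le> measure lebesgue (\<Union>n. G n)"
      using E UG by (intro measure_mono_fmeasurable) auto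
    also have "\<dots> \<le> (b - a) * (C * (x I * w powr (- 1 / r)))"
    proof (rule LIMSEQ_le_const2)
      show "(\<lambda>n. measure lebesgue (G n)) \<longlonglongrightarrow> measure lebesgue (\<Union>n. G n)"
        using G UG \<open>incseq G\<close> by (intro Lim_measure_incseq) (auto simp: fmeasurable_def)
      show "\<exists>N. \<forall>n\<ge>N. measure lebesgue (G n) \<le> (b - a) * (C * (x I * w powr (- 1 / r)))"
        unfolding G_def using level[OF w(1)] by blast
    qed
    also have "\<dots> = C / (z * l) * (LINT t:I|lebesgue. \<bar>f t\<bar>)"
      using ab unfolding w_inv x_def average_def I_def by simp
    finally have "z * measure lebesgue E \<le> z * (C / (z * l) * (LINT t:I|lebesgue. \<bar>f t\<bar>))"
      using z by (intro mult_left_mono) auto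
    also have "\<dots> = C / l * (LINT t:I|lebesgue. \<bar>f t\<bar>)" using z by simp
    finally show ?thesis .
  qed
  then have "measure lebesgue E \<le> C / l * (LINT t:I|lebesgue. \<bar>f t\<bar>)"
    by (rule field_le_mult_one_interval)
  then have "emeasure lebesgue E \<le> ennreal (C / l * (LINT t:I|lebesgue. \<bar>f t\<bar>))"
    using E by (simp add: emeasure_eq_measure2 ennreal_leI)
  then show ?thesis by (simp add: E_def C_def I_def)
qed

section \<open>Extremal sequences\<close>

text \<open>The left-most interval of each generation. The extremal sequence selects these down to
  generation \<open>n + 1\<close> and also the right half of the one in generation \<open>n\<close>. In this way the last
  step covers both halves of \<open>left_chain a b n\<close>; stopping the chain leaves room under the Carleson
  bound for exactly this interval.\<close>
definition left_chain :: "real \<Rightarrow> real \<Rightarrow> nat \<Rightarrow> real set" where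
  "left_chain a b k = {a..<a + (b - a) / 2 ^ k}"

definition extremal_set :: "real \<Rightarrow> real \<Rightarrow> nat \<Rightarrow> real set set" where
  "extremal_set a b n = insert (right_half (left_chain a b n)) (left_chain a b ` {..Suc n})"

lemma left_half_left_chain:
  assumes "a < b"
  shows "left_half (left_chain a b k) = left_chain a b (Suc k)"
  using assms by (simp add: left_chain_def left_half_ivl field_simps)

lemma right_half_left_chain:
  assumes "a < b"
  shows "right_half (left_chain a b k) = {a + (b - a) / 2 ^ Suc k..<a + (b - a) / 2 ^ k}"
  using assms by (simp add: left_chain_def right_half_ivl field_simps)

lemma measure_left_chain:
  assumes "a < b"
  shows "measure lebesgue (left_chain a b k) = (b - a) / 2 ^ k"
  using assms by (simp add: left_chain_def)

lemma measure_right_half_left_chain: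
  assumes "a < b"
  shows "measure lebesgue (right_half (left_chain a b k)) = (b - a) / 2 ^ Suc k"
proof -
  have "a + (b - a) / 2 ^ Suc k \<le> a + (b - a) / 2 ^ k"
    using assms by (simp add: field_simps)
  then show ?thesis
    unfolding right_half_left_chain[OF assms] by (simp add: field_simps)
qed

lemma left_chain_mono:
  assumes "a < b" "k \<le> n"
  shows "left_chain a b n \<subseteq> left_chain a b k"
proof -
  have "(b - a) / 2 ^ n \<le> (b - a) / 2 ^ k"
    using assms by (intro divide_left_mono power_increasing) auto
  then show ?thesis by (auto simp: left_chain_def)
qed

lemma left_chain_inj:
  assumes "a < b"
  shows "inj (left_chain a b)"
proof (rule injI)
  fix k l assume "left_chain a b k = left_chain a b l"
  then have "(b - a) / 2 ^ k = (b - a) / 2 ^ l"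
    by (metis assms measure_left_chain)
  then show "k = l" using assms by simp
qed

lemma left_chain_dyadic_gen:
  assumes "a < b"
  shows "left_chain a b k \<in> dyadic_gen k {a..<b}"
proof (induction k)
  case 0
  show ?case by (simp add: left_chain_def)
next
  case (Suc k)
  then show ?case using left_half_left_chain[OF assms, of k] by auto
qed

lemma extremal_set_subset:
  assumes "a < b"
  shows "extremal_set a b n \<subseteq> dyadic_below (n + 2) {a..<b}"
proof -
  have "right_half (left_chain a b n) \<in> dyadic_gen (Suc n) {a..<b}"
    using left_chain_dyadic_gen[OF assms, of n] by auto
  then have "right_half (left_chain a b n) \<in> dyadic_below (n + 2) {a..<b}"
    unfolding dyadic_below_def by (rule UN_I[rotated]) simp
  moreover have "left_chain a b k \<in> dyadic_below (n + 2) {a..<b}" if "k \<le> Suc n" for k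
    using left_chain_dyadic_gen[OF assms, of k] le_imp_less_Suc[OF that]
    unfolding dyadic_below_def by (intro UN_I[of k]) simp_all
  ultimately show ?thesis by (auto simp: extremal_set_def)
qed

text \<open>The extra summand is the right half of the last but one interval: it has the length of the last
  interval and completes the finite geometric sum to exactly twice its first term.\<close>
lemma sum_inverse_powers_of_2:
  assumes "i \<le> N"
  shows "(\<Sum>k=i..N. 1 / 2 ^ k) + 1 / 2 ^ N = (2 / 2 ^ i :: real)"
  using assms by (induction N rule: dec_induct) (auto simp: field_simps)

text \<open>If \<open>i\<close> is the first index for which the chain interval lies in \<open>J\<close>, the members inside \<open>J\<close> have total
  length at most twice that of the single interval \<open>left_chain a b i\<close>. If there is no such index,
  at most one member lies in \<open>J\<close>.\<close>
lemma extremal_set_packing: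
  assumes ab: "a < b" and J: "J \<in> lmeasurable"
  shows "(\<Sum>K | K \<in> extremal_set a b n \<and> K \<subseteq> J. measure lebesgue K) \<le> 2 * measure lebesgue J"
proof -
  define R where "R = right_half (left_chain a b n)"
  have R: "measure lebesgue R = (b - a) / 2 ^ Suc n"
    unfolding R_def by (rule measure_right_half_left_chain[OF ab])
  have lm: "left_chain a b k \<in> lmeasurable" "R \<in> lmeasurable" for k
    by (auto simp: left_chain_def right_half_def R_def intro: atLeastLessThan_lmeasurable)
  show ?thesis
  proof (cases "\<exists>k\<le>Suc n. left_chain a b k \<subseteq> J")
    case True
    define i where "i = (LEAST k. left_chain a b k \<subseteq> J)"
    obtain k where k: "k \<le> Suc n" "left_chain a b k \<subseteq> J" using True by blast
    have i: "left_chain a b i \<subseteq> J" "\<And>k. left_chain a b k \<subseteq> J \<Longrightarrow> i \<le> k"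
      unfolding i_def by (rule LeastI[where P = "\<lambda>k. left_chain a b k \<subseteq> J", OF k(2)], rule Least_le)
    have "i \<le> Suc n" using i(2)[OF k(2)] k(1) by simp
    have "{K \<in> extremal_set a b n. K \<subseteq> J} \<subseteq> insert R (left_chain a b ` {i..Suc n})"
      using i(2) by (auto simp: extremal_set_def R_def)
    then have "(\<Sum>K | K \<in> extremal_set a b n \<and> K \<subseteq> J. measure lebesgue K)
        \<le> (\<Sum>K\<in>insert R (left_chain a b ` {i..Suc n}). measure lebesgue K)"
      by (intro sum_mono2) auto
    also have "\<dots> \<le> measure lebesgue R + (\<Sum>K\<in>left_chain a b ` {i..Suc n}. measure lebesgue K)"
      by (auto simp: sum.insert_if)
    also have "(\<Sum>K\<in>left_chain a b ` {i..Suc n}. measure lebesgue K)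
        = (\<Sum>k=i..Suc n. (b - a) / 2 ^ k)"
      using left_chain_inj[OF ab]
      by (subst sum.reindex) (auto simp: measure_left_chain[OF ab] intro: inj_on_subset)
    also have "measure lebesgue R + \<dots> = (b - a) * ((\<Sum>k=i..Suc n. 1 / 2 ^ k) + 1 / 2 ^ Suc n)"
      unfolding R by (simp only: sum_distrib_left distrib_left) simp
    also have "\<dots> = 2 * measure lebesgue (left_chain a b i)"
      unfolding sum_inverse_powers_of_2[OF \<open>i \<le> Suc n\<close>] by (simp add: measure_left_chain[OF ab])
    also have "\<dots> \<le> 2 * measure lebesgue J"
      using i(1) lm J by (intro mult_left_mono measure_mono_fmeasurable) auto
    finally show ?thesis .
  next
    case False
    then have "{K \<in> extremal_set a b n. K \<subseteq> J} = (if R \<subseteq> J then {R} else {})"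
      by (auto simp: extremal_set_def R_def)
    moreover have "measure lebesgue R \<le> measure lebesgue J" if "R \<subseteq> J"
      using that lm J by (intro measure_mono_fmeasurable) auto
    moreover have "0 \<le> measure lebesgue J" by simp
    ultimately show ?thesis by (auto simp del: measure_nonneg)
  qed
qed

lemma extremal_indicator_two_carleson:
  assumes ab: "a < b"
  shows "indicator (extremal_set a b n) \<in> two_carleson_seqs {a..<b}"
  unfolding two_carleson_seqs_iff[OF ab]
proof (intro ballI conjI allI)
  fix J m assume "J \<in> dyadic {a..<b}"
  then obtain u v where uv: "J = {u..<v}" "u < v" using dyadic_ivl[OF ab] by blast
  let ?U = "extremal_set a b n"
  show "indicator ?U J \<in> {0, 1 :: real}" by (auto simp: indicator_def)
  have "(\<Sum>K\<in>dyadic_below m J. indicator ?U K * measure lebesgue K)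
      = (\<Sum>K\<in>dyadic_below m J \<inter> ?U. measure lebesgue K)"
    by (rule sum.mono_neutral_cong_right) (auto simp: indicator_def)
  also have "\<dots> \<le> (\<Sum>K | K \<in> ?U \<and> K \<subseteq> J. measure lebesgue K)"
    using dyadic_subset[OF uv(2)] dyadic_below_subset uv(1)
    by (intro sum_mono2) (auto simp: extremal_set_def)
  also have "\<dots> \<le> 2 * measure lebesgue J"
    unfolding uv(1) by (intro extremal_set_packing[OF ab] atLeastLessThan_lmeasurable)
  finally show "partial_carleson (indicator ?U) m J \<le> 2"
    using uv by (simp add: partial_carleson_def divide_le_eq)
qed

text \<open>The value of the sum inside the operator on \<open>left_chain a b n\<close>, for the indicator of that
  interval: generation \<open>k\<close> contributes the average \<open>2 ^ k / 2 ^ n\<close> to the power \<open>r\<close>, and the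
  final layer contributes 1.\<close>
definition extremal_value :: "real \<Rightarrow> nat \<Rightarrow> real" where
  "extremal_value r n = (\<Sum>k\<le>n. (2 ^ k / 2 ^ n) powr r) + 1"

lemma average_indicator:
  assumes "E \<in> lmeasurable" "J \<in> lmeasurable"
  shows "average (\<lambda>t. \<bar>indicator E t\<bar>) J = measure lebesgue (E \<inter> J) / measure lebesgue J"
proof -
  have "(\<lambda>t. indicator J t *\<^sub>R \<bar>indicator E t\<bar>) = (indicator (E \<inter> J) :: real \<Rightarrow> real)"
    by (auto simp: indicator_def)
  then show ?thesis by (simp add: average_def set_lebesgue_integral_def)
qed

lemma extremal_value_le_partial_sparse:
  assumes ab: "a < b" and r: "r > 0" and t: "t \<in> left_chain a b n"
  shows "extremal_value r n \<le> partial_sparse (indicator (extremal_set a b n))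
    (average (\<lambda>t. \<bar>indicator (left_chain a b n) t\<bar>)) r (n + 2) {a..<b} t"
proof -
  let ?J = "left_chain a b" and ?U = "extremal_set a b n"
  define x where "x = average (\<lambda>t. \<bar>indicator (?J n) t :: real\<bar>)"
  \<comment> \<open>The final layer: the half of the last interval that contains the given point.\<close>
  define Q where "Q = (if t \<in> ?J (Suc n) then ?J (Suc n) else right_half (?J n))"
  have lm: "?J k \<in> lmeasurable" for k
    unfolding left_chain_def by (rule atLeastLessThan_lmeasurable)
  have R: "right_half (?J n) \<subseteq> ?J n" "right_half (?J n) \<in> lmeasurable"
    using ab unfolding right_half_left_chain[OF ab]
    by (auto simp: left_chain_def atLeastLessThan_lmeasurable)
  have tQ: "t \<in> Q"
    using t unfolding Q_def right_half_left_chain[OF ab] by (auto simp: left_chain_def)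
  have QU: "Q \<in> ?U" by (auto simp: Q_def extremal_set_def)
  have Q: "Q \<subseteq> ?J n" "Q \<in> lmeasurable" "measure lebesgue Q = (b - a) / 2 ^ Suc n"
    using R left_chain_mono[OF ab, of n "Suc n"] lm
    by (auto simp: Q_def measure_left_chain[OF ab] measure_right_half_left_chain[OF ab])
  have xQ: "x Q = 1"
    using Q ab unfolding x_def by (subst average_indicator) (auto simp: lm Int_absorb1)
  have xJ: "x (?J k) = 2 ^ k / 2 ^ n" if "k \<le> n" for k
    using left_chain_mono[OF ab that] ab unfolding x_def
    by (subst average_indicator) (auto simp: lm Int_absorb2 measure_left_chain)
  have "Q \<notin> ?J ` {..n}"
  proof
    assume "Q \<in> ?J ` {..n}"
    then obtain k where k: "k \<le> n" "Q = ?J k" by auto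
    then have "(2::real) ^ k = 2 ^ Suc n"
      using Q(3) ab unfolding k(2) measure_left_chain[OF ab] by (simp del: power_Suc)
    then have "k = Suc n" using power_inject_exp[of "2::real" k "Suc n"] by simp
    then show False using k by simp
  qed
  then have "(\<Sum>K\<in>insert Q (?J ` {..n}). x K powr r) = 1 + (\<Sum>K\<in>?J ` {..n}. x K powr r)"
    by (simp add: xQ)
  also have "(\<Sum>K\<in>?J ` {..n}. x K powr r) = (\<Sum>k\<le>n. (2 ^ k / 2 ^ n) powr r)"
    using left_chain_inj[OF ab] by (subst sum.reindex) (auto simp: xJ intro: inj_on_subset)
  finally have "extremal_value r n = (\<Sum>K\<in>insert Q (?J ` {..n}). x K powr r)"
    by (simp add: extremal_value_def)
  also have "\<dots> = (\<Sum>K\<in>insert Q (?J ` {..n}). indicator ?U K * x K powr r * indicator K t)"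
  proof (rule sum.cong)
    fix K assume K: "K \<in> insert Q (?J ` {..n})"
    then have "K \<in> ?U" using QU by (auto simp: extremal_set_def)
    moreover have "t \<in> K" using K tQ t left_chain_mono[OF ab, of _ n] by auto
    ultimately show "x K powr r = indicator ?U K * x K powr r * indicator K t" by simp
  qed simp
  also have "\<dots> \<le> partial_sparse (indicator ?U) x r (n + 2) {a..<b} t"
    unfolding partial_sparse_def
  proof (rule sum_mono2)
    have "?J ` {..n} \<subseteq> ?U" by (auto simp: extremal_set_def)
    then show "insert Q (?J ` {..n}) \<subseteq> dyadic_below (n + 2) {a..<b}"
      using QU extremal_set_subset[OF ab, of n] by blast
  qed auto
  finally show ?thesis by (simp add: x_def)
qed

text \<open>Testing with the indicator of \<open>left_chain a b n\<close>: the operator is at least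
  \<open>extremal_value r n powr (1 / r)\<close> on a set whose measure equals the \<open>L\<^sup>1\<close> norm of that indicator.
  The level set is shown to be measurable since \<^const>\<open>emeasure\<close> would vanish on a
  non-measurable set.\<close>
lemma extremal_value_le_weak_type_norm:
  assumes ab: "a < b" and r: "r > 0"
  shows "ennreal (extremal_value r n powr (1 / r))
    \<le> weak_type_norm {a..<b} (sparse_op {a..<b} (indicator (extremal_set a b n)) r)"
  unfolding weak_type_norm_def
proof (rule Inf_greatest, clarify)
  let ?\<alpha> = "indicator (extremal_set a b n) :: real set \<Rightarrow> real"
  fix C :: real
  assume C0: "0 \<le> C" and C: "\<forall>f l. set_integrable lebesgue {a..<b} f \<longrightarrow> 0 < l \<longrightarrow>
    emeasure lebesgue {t \<in> {a..<b}. ennreal l \<le> sparse_op {a..<b} ?\<alpha> r f t}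
      \<le> ennreal (C / l * (LINT t:{a..<b}|lebesgue. \<bar>f t\<bar>))"
  define J where "J = left_chain a b n"
  define f where "f = (indicator J :: real \<Rightarrow> real)"
  define v where "v = extremal_value r n"
  define l where "l = v powr (1 / r)"
  have v: "v > 0" unfolding v_def extremal_value_def by (intro add_nonneg_pos sum_nonneg) auto
  then have l: "l > 0" by (simp add: l_def)
  have JI: "J \<subseteq> {a..<b}" using left_chain_mono[OF ab, of 0 n] by (simp add: J_def left_chain_def)
  have J: "J \<in> lmeasurable" unfolding J_def left_chain_def by (rule atLeastLessThan_lmeasurable)
  have mJ: "measure lebesgue J > 0" using ab by (simp add: J_def measure_left_chain)
  have eq: "(\<lambda>t. indicator {a..<b} t *\<^sub>R f t) = indicator J"
    "(\<lambda>t. indicator {a..<b} t *\<^sub>R \<bar>f t\<bar>) = indicator J"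
    using JI by (auto simp: f_def indicator_def fun_eq_iff)
  have fint: "set_integrable lebesgue {a..<b} f"
    unfolding set_integrable_def eq using J by (intro integrable_real_indicator) (auto simp: fmeasurable_def)
  have bin: "?\<alpha> K \<in> {0, 1}" for K by (auto simp: indicator_def)
  have "J \<subseteq> {t \<in> {a..<b}. ennreal l \<le> sparse_op {a..<b} ?\<alpha> r f t}"
  proof safe
    fix t assume t: "t \<in> J"
    then show "t \<in> {a..<b}" using JI by blast
    have "l powr r = v" using v r by (simp add: l_def powr_powr)
    moreover have "v \<le> partial_sparse ?\<alpha> (average (\<lambda>t. \<bar>f t\<bar>)) r (n + 2) {a..<b} t"
      using extremal_value_le_partial_sparse[OF ab r] t by (simp add: v_def f_def J_def)
    ultimately have "ennreal (l powr r) \<le>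
        (SUP m. ennreal (partial_sparse ?\<alpha> (average (\<lambda>t. \<bar>f t\<bar>)) r m {a..<b} t))"
      by (intro SUP_upper2[of "n + 2"]) (auto intro: ennreal_leI)
    then show "ennreal l \<le> sparse_op {a..<b} ?\<alpha> r f t"
      using bin r l by (subst sparse_op_ge_iff) auto
  qed
  moreover have "{t \<in> {a..<b}. ennreal l \<le> sparse_op {a..<b} ?\<alpha> r f t} \<in> sets lebesgue"
    using sparse_op_level_borel[OF bin r l ab] by auto
  ultimately have "emeasure lebesgue J
      \<le> emeasure lebesgue {t \<in> {a..<b}. ennreal l \<le> sparse_op {a..<b} ?\<alpha> r f t}"
    by (rule emeasure_mono)
  also have "\<dots> \<le> ennreal (C / l * (LINT t:{a..<b}|lebesgue. \<bar>f t\<bar>))"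
    using C fint l by blast
  also have "(LINT t:{a..<b}|lebesgue. \<bar>f t\<bar>) = measure lebesgue J"
    unfolding set_lebesgue_integral_def eq by simp
  finally have "measure lebesgue J \<le> C / l * measure lebesgue J"
    using J C0 l by (simp add: emeasure_eq_measure2)
  then have "l \<le> C" using mJ l by (simp add: field_simps)
  then show "ennreal (extremal_value r n powr (1 / r)) \<le> ennreal C"
    unfolding l_def v_def by (rule ennreal_leI)
qed

lemma extremal_value_tendsto:
  assumes r: "r > 0"
  shows "(\<lambda>n. extremal_value r n) \<longlonglongrightarrow> 1 + carleson_weight r"
proof -
  define q where "q = (2::real) powr - r"
  have q: "0 < q" "q < 1" using r by (auto simp: q_def powr_less_one)
  have "extremal_value r n = (\<Sum>j<Suc n. q ^ j) + 1" for n
  proof -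
    have "(\<Sum>k\<le>n. ((2::real) ^ k / 2 ^ n) powr r) = (\<Sum>k\<le>n. q ^ (n - k))"
    proof (rule sum.cong)
      fix k assume "k \<in> {..n}"
      then have "(2::real) ^ n = 2 ^ k * 2 ^ (n - k)"
        by (simp flip: power_add)
      then have "(2::real) ^ k / 2 ^ n = 2 powr - real (n - k)"
        by (simp add: powr_minus_divide powr_realpow)
      also have "\<dots> powr r = q ^ (n - k)"
        by (simp add: q_def powr_powr powr_power mult.commute)
      finally show "((2::real) ^ k / 2 ^ n) powr r = q ^ (n - k)" .
    qed simp
    also have "\<dots> = (\<Sum>j\<le>n. q ^ j)" by (rule sum.reindex_bij_witness[of _ "\<lambda>j. n - j" "\<lambda>j. n - j"]) auto
    finally show ?thesis by (simp add: extremal_value_def lessThan_Suc_atMost)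
  qed
  moreover have "(\<lambda>n. (\<Sum>j<Suc n. q ^ j) + 1) \<longlonglongrightarrow> 1 / (1 - q) + 1"
    using geometric_sums[of q] q unfolding sums_def
    by (intro tendsto_add tendsto_const LIMSEQ_Suc) auto
  moreover have "1 / (1 - q) = carleson_weight r"
    using r by (simp add: q_def carleson_weight_def powr_minus field_simps)
  ultimately show ?thesis by (simp add: add.commute)
qed

section \<open>The sharp constant\<close>

theorem proposition1:
  fixes a b r :: real
  assumes "a < b" and "r > 0"
  shows "(SUP \<alpha>\<in>two_carleson_seqs {a..<b}. weak_type_norm {a..<b} (sparse_op {a..<b} \<alpha> r))
           = ennreal (((2 powr (r + 1) - 1) / (2 powr r - 1)) powr (1 / r))"
proof -
  define C where "C = (1 + carleson_weight r) powr (1 / r)"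
  have "2 powr r \<noteq> (1::real)" using \<open>r > 0\<close> by simp
  then have C: "((2 powr (r + 1) - 1) / (2 powr r - 1)) powr (1 / r) = C"
    by (simp add: C_def carleson_weight_def powr_add field_simps)
  show ?thesis
    unfolding C
  proof (rule antisym)
    show "(SUP \<alpha>\<in>two_carleson_seqs {a..<b}. weak_type_norm {a..<b} (sparse_op {a..<b} \<alpha> r)) \<le> ennreal C"
    proof (rule SUP_least)
      fix \<alpha> assume "\<alpha> \<in> two_carleson_seqs {a..<b}"
      then show "weak_type_norm {a..<b} (sparse_op {a..<b} \<alpha> r) \<le> ennreal C"
        unfolding weak_type_norm_def C_def
        by (intro Inf_lower CollectI exI[of _ "(1 + carleson_weight r) powr (1 / r)"] conjI refl
          powr_ge_zero allI impI sparse_op_weak_type assms)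
    qed
    show "ennreal C \<le> (SUP \<alpha>\<in>two_carleson_seqs {a..<b}. weak_type_norm {a..<b} (sparse_op {a..<b} \<alpha> r))"
    proof (rule LIMSEQ_le_const2)
      have "1 + carleson_weight r \<noteq> 0" using carleson_weight_pos[OF \<open>r > 0\<close>] by simp
      then show "(\<lambda>n. ennreal (extremal_value r n powr (1 / r))) \<longlonglongrightarrow> ennreal C"
        unfolding C_def
        by (intro tendsto_ennrealI tendsto_powr extremal_value_tendsto tendsto_const assms)
      have "ennreal (extremal_value r n powr (1 / r))
          \<le> (SUP \<alpha>\<in>two_carleson_seqs {a..<b}. weak_type_norm {a..<b} (sparse_op {a..<b} \<alpha> r))" for n
        by (rule SUP_upper2, rule extremal_indicator_two_carleson[OF assms(1)],
          rule extremal_value_le_weak_type_norm[OF assms])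
      then show "\<exists>N. \<forall>n\<ge>N. ennreal (extremal_value r n powr (1 / r))
          \<le> (SUP \<alpha>\<in>two_carleson_seqs {a..<b}. weak_type_norm {a..<b} (sparse_op {a..<b} \<alpha> r))"
        by blast
    qed
  qed
qed

end
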